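(* Let $\eta,\eta'\in\mathbb{C}$ and let $w,x,y,z\in\mathbb{Z}/3\mathbb{Z}$ with $y\neq z$. Then the generalized median operator $\mathcal{M}^{wx/yz}[\eta,\eta']$ is a generalized cevian operator; precisely, $$\mathcal{M}^{wx/yz}[\eta,\eta']=\mathcal{S}[\eta_0,\eta_1],$$ where $$\eta_0=\frac{\eta\,\omega^{-x}-\omega^{-w}}{\omega^{-z}-\omega^{-y}},\qquad \eta_1=\frac{\eta'\,\omega^{x}-\omega^{w}}{\omega^{z}-\omega^{y}}.$$
   Context: Let $\omega=e^{2\pi i/3}$; $\omega^{x}$ makes sense for $x\in\mathbb{Z}/3\mathbb{Z}$. A triangle triple is a vector $\Delta=(a_0,a_1,a_2)\in\mathbb{C}^3$ (degenerate triples allowed), viewed as a column vector with coordinates indexed by $\mathbb{Z}/3\mathbb{Z}$; its centroid is $\frac13(a_0+a_1+a_2)$. Put $$W=\begin{pmatrix}1&1&1\\1&\omega&\omega^2\\1&\omega^2&\omega\end{pmatrix}.$$ Generalized cevian operator: for $\eta,\eta'\in\mathbb{C}$, $\mathcal{S}[\eta,\eta']:=W\,\mathrm{diag}(1,\eta',\eta)\,W^{-1}\in M_3(\mathbb{C})$, acting on $\mathbb{C}^3$ on the left. It preserves centroids. Generalized median operator: for $\eta,\eta'\in\mathbb{C}$ and $w,x,y,z\in\mathbb{Z}/3\mathbb{Z}$ with $y\ne z$, and a triangle triple $\Delta=(a_0,a_1,a_2)$ with $\mathcal{S}[\eta,\eta'](\Delta)=(a_0',a_1',a_2')$, define $\mathcal{M}^{wx/yz}[\eta,\eta'](\Delta)=(a_0'',a_1'',a_2'')$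 to be the unique triangle triple having the same centroid as $\Delta$ and satisfying $a'_{x+k}-a_{w+k}=a''_{z+k}-a''_{y+k}$ for all $k\in\mathbb{Z}/3\mathbb{Z}$. The operator $\mathcal{M}^{wx/yz}[\eta,\eta']$ is linear and is identified with its matrix in $M_3(\mathbb{C})$. *)

theory Defs
  imports "HOL-Analysis.Analysis"
begin

text \<open>
  The numeral type \<open>3\<close> is the ring of integers modulo 3 (in it, \<open>3 = 0\<close>), so \<open>complex^3\<close>
  consists of the complex triples with coordinates indexed by that ring.
  The library's list-based constructor \<open>vector\<close> starts at index 1, which would put the first
  entry at 1 and the third one at 0; \<open>triple\<close> starts at index 0.
\<close>

definition triple :: "'a \<Rightarrow> 'a \<Rightarrow> 'a \<Rightarrow> 'a ^ 3" where
  "triple u v w = (\<chi> i. if i = 0 then u else if i = 1 then v else w)"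

definition diag :: "complex ^ 3 \<Rightarrow> complex ^ 3 ^ 3" where
  "diag d = (\<chi> i j. if i = j then d $ i else 0)"

definition omega :: complex where
  "omega = exp (2 * of_real pi * \<i> / 3)"

text \<open>\<open>Rep_bit1 x\<close> is the representative of \<open>x\<close> in \<open>{0, 1, 2}\<close>.\<close>

definition omega_pow :: "3 \<Rightarrow> complex" where
  "omega_pow x = omega ^ nat (Rep_bit1 x)"

definition W :: "complex ^ 3 ^ 3" where
  "W = triple (triple 1 1 1)
              (triple 1 omega (omega ^ 2))
              (triple 1 (omega ^ 2) omega)"

definition centroid :: "complex ^ 3 \<Rightarrow> complex" where
  "centroid \<Delta> = 1 / 3 * (\<Delta> $ 0 + \<Delta> $ 1 + \<Delta> $ 2)"

text \<open>Note the order of the parameters on the diagonal.\<close>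

definition gen_cevian :: "complex \<Rightarrow> complex \<Rightarrow> complex ^ 3 ^ 3" where
  "gen_cevian \<eta> \<eta>' = W ** diag (triple 1 \<eta>' \<eta>) ** matrix_inv W"

definition is_median_triple ::
  "3 \<Rightarrow> 3 \<Rightarrow> 3 \<Rightarrow> 3 \<Rightarrow> complex \<Rightarrow> complex \<Rightarrow> complex ^ 3 \<Rightarrow> complex ^ 3 \<Rightarrow> bool" where
  "is_median_triple w x y z \<eta> \<eta>' \<Delta> \<Delta>'' \<longleftrightarrow>
     centroid \<Delta>'' = centroid \<Delta> \<and>
     (\<forall>k. (gen_cevian \<eta> \<eta>' *v \<Delta>) $ (x + k) - \<Delta> $ (w + k) = \<Delta>'' $ (z + k) - \<Delta>'' $ (y + k))"

text \<open>Meaningful only for \<open>y \<noteq> z\<close>; see \<open>ex1_median_triple\<close> below.\<close>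

definition gen_median ::
  "3 \<Rightarrow> 3 \<Rightarrow> 3 \<Rightarrow> 3 \<Rightarrow> complex \<Rightarrow> complex \<Rightarrow> complex ^ 3 \<Rightarrow> complex ^ 3" where
  "gen_median w x y z \<eta> \<eta>' \<Delta> = (THE \<Delta>''. is_median_triple w x y z \<eta> \<eta>' \<Delta> \<Delta>'')"


lemma three_cases: "(i::3) = 0 \<or> i = 1 \<or> i = 2"
  using exhaust_3[of i] by auto

lemma all_3: "(\<forall>i::3. P i) \<longleftrightarrow> P 0 \<and> P 1 \<and> P 2"
  by (metis three_cases)

lemma sum_UNIV_3: "sum f (UNIV :: 3 set) = f 0 + f 1 + f 2"
proof -
  have "(3::3) = 0" by simp
  then show ?thesis using sum_3[of f] by (metis add.commute add.assoc)
qed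

lemma arith_3: "(1::3) + 1 = 2" "(1::3) + 2 = 0" "(2::3) + 1 = 0" "(2::3) + 2 = 1" "(3::3) = 0" "(4::3) = 1" "(- 1::3) = 2" "(- 2::3) = 1"
  by simp_all

lemma triple_nth [simp]:
  "triple u v w $ 0 = u" "triple u v w $ 1 = v" "triple u v w $ 2 = w"
  by (simp_all add: triple_def)

lemma omega_cubed: "omega ^ 3 = 1"
proof -
  have "omega ^ 3 = exp (of_nat 3 * (2 * of_real pi * \<i> / 3))"
    unfolding omega_def by (rule exp_of_nat_mult[symmetric])
  also have "of_nat 3 * (2 * of_real pi * \<i> / 3) = 2 * of_real pi * \<i>" by simp
  finally show ?thesis by (simp only: exp_two_pi_i)
qed

lemma omega_neq_1: "omega \<noteq> 1"
proof
  assume "omega = 1"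
  then have "Im omega = 0" by simp
  then have "sin (2 * pi / 3) = 0" by (simp add: omega_def Im_exp)
  moreover have "sin (2 * pi / 3) > 0" by (rule sin_gt_zero) auto
  ultimately show False by simp
qed

lemma omega_sum: "1 + omega + omega ^ 2 = 0"
proof -
  have "(omega - 1) * (1 + omega + omega ^ 2) = 0"
    using omega_cubed by (simp add: algebra_simps power2_eq_square power3_eq_cube)
  then show ?thesis using omega_neq_1 by simp
qed

lemma omega_pow_of_int: "omega_pow (of_int k) = omega powi k"
proof -
  have nz: "omega \<noteq> 0" by (simp add: omega_def)
  have "Rep_bit1 (of_int k :: 3) = k mod 3"
    by (simp add: bit1.of_int_eq Abs_bit1_inverse)
  then have "omega_pow (of_int k) = omega powi (k mod 3)"
    by (simp add: omega_pow_def power_int_def)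
  also have "\<dots> = omega powi (3 * (k div 3)) * omega powi (k mod 3)"
    using omega_cubed by (simp add: power_int_mult)
  also have "\<dots> = omega powi (3 * (k div 3) + k mod 3)"
    using nz by (subst power_int_add) auto
  finally show ?thesis by simp
qed

lemma invertible_W: "invertible W"
proof -
  define V :: "complex ^ 3 ^ 3" where
    "V = triple (triple (1/3) (1/3) (1/3))
                (triple (1/3) (omega ^ 2 / 3) (omega / 3))
                (triple (1/3) (omega / 3) (omega ^ 2 / 3))"
  have o: "omega ^ 2 = - 1 - omega" "omega * omega = - 1 - omega"
    using omega_sum by algebra+
  have "W ** V = mat 1"
    by (simp add: vec_eq_iff all_3 matrix_matrix_mult_def sum_UNIV_3 mat_def W_def V_def
        o algebra_simps) (simp add: o field_simps)
  then show ?thesis using invertible_right_inverse by blast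
qed

lemma matrix_inv_W: "W ** matrix_inv W = mat 1" "matrix_inv W ** W = mat 1"
  using invertible_W unfolding invertible_def matrix_inv_def
  by (metis (mono_tags, lifting) someI_ex)+

lemma centroid_gen_cevian: "centroid (gen_cevian \<eta> \<eta>' *v \<Delta>) = centroid \<Delta>"
proof -
  have W_sum: "centroid (W *v u) = u $ 0" for u
  proof -
    have "centroid (W *v u) = 1 / 3 * (3 * u $ 0 + (1 + omega + omega ^ 2) * (u $ 1 + u $ 2))"
      by (simp add: centroid_def W_def matrix_vector_mult_def sum_UNIV_3 algebra_simps)
    then show ?thesis by (simp add: omega_sum)
  qed
  define u where "u = matrix_inv W *v \<Delta>"
  have \<Delta>: "\<Delta> = W *v u"
    by (simp add: u_def matrix_vector_mul_assoc matrix_inv_W)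
  have "gen_cevian \<eta> \<eta>' *v \<Delta> = W *v (diag (triple 1 \<eta>' \<eta>) *v u)"
    by (simp add: gen_cevian_def u_def matrix_vector_mul_assoc matrix_mul_assoc)
  then show ?thesis
    unfolding \<Delta> by (simp add: W_sum) (simp add: diag_def matrix_vector_mult_def sum_UNIV_3)
qed

lemma ex1_difference_triple:
  fixes d :: "complex ^ 3"
  assumes "y \<noteq> z" and "d $ 0 + d $ 1 + d $ 2 = 0"
  shows "\<exists>!v. centroid v = c \<and> (\<forall>k. d $ k = v $ (z + k) - v $ (y + k))"
proof -
  define v where "v = (\<chi> i. c + (d $ (i - z) - d $ (i - y)) / 3)"
  have d2: "d $ 2 = - d $ 0 - d $ 1" using assms(2) by algebra
  have "centroid v = c \<and> (\<forall>k. d $ k = v $ (z + k) - v $ (y + k))"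
    using three_cases[of y] three_cases[of z] assms(1)
    by (elim disjE) (simp_all add: v_def centroid_def all_3 arith_3 d2 field_simps)
  moreover have "v1 = v2"
    if "centroid v1 = c \<and> (\<forall>k. d $ k = v1 $ (z + k) - v1 $ (y + k))"
       "centroid v2 = c \<and> (\<forall>k. d $ k = v2 $ (z + k) - v2 $ (y + k))" for v1 v2
  proof -
    define e where "e = v1 - v2"
    have "e $ (z + k) = e $ (y + k)" for k
      using that by (simp add: e_def algebra_simps)
    then have "e $ 0 = e $ 1 \<and> e $ 1 = e $ 2"
      using three_cases[of y] three_cases[of z] assms(1) by (metis arith_3 add.commute add_0)
    moreover have "e $ 0 + e $ 1 + e $ 2 = 0"
    proof -
      have "centroid v1 = centroid v2" using that by simp
      then have "v1 $ 0 + v1 $ 1 + v1 $ 2 = v2 $ 0 + v2 $ 1 + v2 $ 2"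
        unfolding centroid_def mult_cancel_left by simp
      then show ?thesis by (simp add: e_def algebra_simps)
    qed
    ultimately have "\<forall>i. e $ i = 0" by (simp add: all_3)
    then show ?thesis by (simp add: e_def vec_eq_iff)
  qed
  ultimately show ?thesis by blast
qed

lemma ex1_median_triple:
  assumes "y \<noteq> z"
  shows "\<exists>!\<Delta>''. is_median_triple w x y z \<eta> \<eta>' \<Delta> \<Delta>''"
proof -
  define b where "b = gen_cevian \<eta> \<eta>' *v \<Delta>"
  define d where "d = (\<chi> k. b $ (x + k) - \<Delta> $ (w + k))"
  have shift: "v $ (i + 0) + v $ (i + 1) + v $ (i + 2) = 3 * centroid v"
    for v :: "complex ^ 3" and i :: 3
    using three_cases[of i] by (elim disjE) (simp_all add: arith_3 centroid_def)
  have "centroid b = centroid \<Delta>"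
    unfolding b_def by (rule centroid_gen_cevian)
  then have "d $ 0 + d $ 1 + d $ 2 = 0"
    using shift[of b x] shift[of \<Delta> w] by (simp add: d_def algebra_simps)
  from ex1_difference_triple[OF assms this] show ?thesis
    by (simp add: is_median_triple_def d_def b_def)
qed

end

theory Submission
  imports Defs
begin

text \<open>
  The columns of \<open>W\<close> are the characters of the cyclic group of order 3, so \<open>W *v u\<close> has the
  entries \<open>u\<^sub>0 + \<omega>\<^sup>i u\<^sub>1 + \<omega>\<^sup>-\<^sup>i u\<^sub>2\<close>. In these Fourier coordinates shifting the index and applying
  a cevian operator are both diagonal, and the equations defining the median operator split
  into one linear equation for each nontrivial character, solved by \<open>\<eta>\<^sub>1\<close> and \<open>\<eta>\<^sub>0\<close>.
\<close>

lemma omega_pow_simps: "omega_pow 0 = 1" "omega_pow 1 = omega" "omega_pow 2 = omega ^ 2"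
  using omega_pow_of_int[of 0] omega_pow_of_int[of 1] omega_pow_of_int[of 2] by simp_all

lemma omega_pow_add: "omega_pow (i + j) = omega_pow i * omega_pow j"
proof -
  \<comment> \<open>Exponents are representatives in {0, 1, 2}; this fact settles the sums that wrap
    around modulo 3.\<close>
  have "omega * (omega * omega) = 1"
    using omega_cubed by (simp add: power3_eq_cube mult.assoc)
  then show ?thesis
    using three_cases[of i] three_cases[of j]
    by (elim disjE) (simp_all add: arith_3 omega_pow_simps power2_eq_square mult.assoc)
qed

text \<open>As \<open>omega\<close> is a primitive cube root of unity, its three powers are
  distinct. This makes both denominators in the theorem nonzero.\<close>

lemma omega_pow_eq_iff: "omega_pow i = omega_pow j \<longleftrightarrow> i = j"
proof
  assume "omega_pow i = omega_pow j"
  then have "omega_pow (i - j) * omega_pow j = 1 * omega_pow j"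
    by (simp flip: omega_pow_add)
  moreover have "omega_pow j * omega_pow (- j) = 1"
    by (simp add: omega_pow_simps flip: omega_pow_add)
  ultimately have eq1: "omega_pow (i - j) = 1"
    by auto
  have "omega ^ 2 \<noteq> 1"
    using omega_cubed omega_neq_1 by (auto simp: power2_eq_square power3_eq_cube)
  with eq1 omega_neq_1 have "i - j = 0"
    using three_cases[of "i - j"] by (auto simp: omega_pow_simps)
  then show "i = j" by simp
qed simp

text \<open>The last column of \<open>W\<close> has the entries \<open>omega_pow (2 * i)\<close>,
  and \<open>2 = - 1\<close> in the type \<open>3\<close>.\<close>

lemma W_mult_nth:
  "(W *v u) $ i = u $ 0 + omega_pow i * u $ 1 + omega_pow (- i) * u $ 2"
  using three_cases[of i]
  by (elim disjE)
     (simp_all add: W_def matrix_vector_mult_def sum_UNIV_3 omega_pow_simps arith_3)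

lemma gen_cevian_W_mult:
  "gen_cevian \<eta> \<eta>' *v (W *v u) = W *v triple (u $ 0) (\<eta>' * u $ 1) (\<eta> * u $ 2)"
proof -
  have "gen_cevian \<eta> \<eta>' *v (W *v u)
      = W *v (diag (triple 1 \<eta>' \<eta>) *v ((matrix_inv W ** W) *v u))"
    by (simp add: gen_cevian_def matrix_vector_mul_assoc matrix_mul_assoc)
  also have "\<dots> = W *v (diag (triple 1 \<eta>' \<eta>) *v u)"
    by (simp add: matrix_inv_W)
  also have "diag (triple 1 \<eta>' \<eta>) *v u = triple (u $ 0) (\<eta>' * u $ 1) (\<eta> * u $ 2)"
    by (simp add: vec_eq_iff all_3 diag_def matrix_vector_mult_def sum_UNIV_3)
  finally show ?thesis .
qed

text \<open>The hypotheses compare coefficients at the two nontrivial characters, with the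
  denominators cleared.\<close>

lemma is_median_triple_gen_cevian:
  assumes eq0: "\<eta>\<^sub>0 * (omega_pow (- z) - omega_pow (- y)) = \<eta> * omega_pow (- x) - omega_pow (- w)"
    and eq1: "\<eta>\<^sub>1 * (omega_pow z - omega_pow y) = \<eta>' * omega_pow x - omega_pow w"
  shows "is_median_triple w x y z \<eta> \<eta>' \<Delta> (gen_cevian \<eta>\<^sub>0 \<eta>\<^sub>1 *v \<Delta>)"
proof -
  define u where "u = matrix_inv W *v \<Delta>"
  have \<Delta>: "\<Delta> = W *v u"
    by (simp add: u_def matrix_vector_mul_assoc matrix_inv_W)
  have "(gen_cevian \<eta> \<eta>' *v \<Delta>) $ (x + k) - \<Delta> $ (w + k)
      = (gen_cevian \<eta>\<^sub>0 \<eta>\<^sub>1 *v \<Delta>) $ (z + k) - (gen_cevian \<eta>\<^sub>0 \<eta>\<^sub>1 *v \<Delta>) $ (y + k)" for k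
  proof -
    have neg: "omega_pow (- (i + k)) = omega_pow (- i) * omega_pow (- k)" for i
      by (simp flip: omega_pow_add)
    \<comment> \<open>Cevian operators fix the coefficient \<open>u $ 0\<close> of the trivial
      character, so it cancels in the difference.\<close>
    have "(gen_cevian \<eta> \<eta>' *v \<Delta>) $ (x + k) - \<Delta> $ (w + k)
        = (\<eta>' * omega_pow x - omega_pow w) * omega_pow k * u $ 1
          + (\<eta> * omega_pow (- x) - omega_pow (- w)) * omega_pow (- k) * u $ 2"
      unfolding \<Delta> gen_cevian_W_mult W_mult_nth triple_nth neg omega_pow_add
      by (simp add: algebra_simps)
    also have "\<dots> = (gen_cevian \<eta>\<^sub>0 \<eta>\<^sub>1 *v \<Delta>) $ (z + k) - (gen_cevian \<eta>\<^sub>0 \<eta>\<^sub>1 *v \<Delta>) $ (y + k)"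
      unfolding \<Delta> gen_cevian_W_mult W_mult_nth triple_nth neg omega_pow_add
        eq0[symmetric] eq1[symmetric]
      by (simp add: algebra_simps)
    finally show ?thesis .
  qed
  then show ?thesis
    by (simp add: is_median_triple_def centroid_gen_cevian)
qed

theorem corollary3p8:
  fixes \<eta> \<eta>' :: complex and w x y z :: 3
  assumes "y \<noteq> z"
  defines "\<eta>\<^sub>0 \<equiv> (\<eta> * omega_pow (- x) - omega_pow (- w)) / (omega_pow (- z) - omega_pow (- y))"
    and "\<eta>\<^sub>1 \<equiv> (\<eta>' * omega_pow x - omega_pow w) / (omega_pow z - omega_pow y)"
  shows "gen_median w x y z \<eta> \<eta>' = (\<lambda>\<Delta>. gen_cevian \<eta>\<^sub>0 \<eta>\<^sub>1 *v \<Delta>) \<and>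
         matrix (gen_median w x y z \<eta> \<eta>') = gen_cevian \<eta>\<^sub>0 \<eta>\<^sub>1"
proof -
  have "is_median_triple w x y z \<eta> \<eta>' \<Delta> (gen_cevian \<eta>\<^sub>0 \<eta>\<^sub>1 *v \<Delta>)" for \<Delta>
    using assms(1)
    by (intro is_median_triple_gen_cevian) (auto simp: \<eta>\<^sub>0_def \<eta>\<^sub>1_def omega_pow_eq_iff)
  \<comment> \<open>The median triple is unique, so exhibiting one evaluates the
    \<open>THE\<close>.\<close>
  then have "gen_median w x y z \<eta> \<eta>' = (\<lambda>\<Delta>. gen_cevian \<eta>\<^sub>0 \<eta>\<^sub>1 *v \<Delta>)"
    unfolding gen_median_def using ex1_median_triple[OF assms(1)]
    by (intro ext the1_equality)
  then show ?thesis
    by (simp add: matrix_of_matrix_vector_mul)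
qed

end
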